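(* For every triple of positive integers $r,k,g$ with $r\ge 3$, there exists a tranquil $r$-uniform hypergraph with chromatic number at least $k$ and girth at least $g$.
   Context: A closed walk of length $\ell$ in a hypergraph $H$ is a sequence $v_0F_0v_1F_1\ldots F_{\ell-1}v_0$ of alternating vertices and hyperedges such that $v_i,v_{i+1}\in F_i$ for all $0\le i<\ell$ (indices mod $\ell$), $F_i\neq F_{i+1}$ for each $0\le i<\ell$ (indices mod $\ell$), and $v_1,\ldots,v_{\ell-1}$ are pairwise distinct. An $r$-uniform hypergraph $H$ is tranquil if there is a family of labellings $\lambda=\{\lambda_F\}_{F\in E(H)}$, with $\lambda_F:F\to\{1,\ldots,r\}$, such that for every closed walk $W=v_0F_0v_1\ldots F_{\ell-1}v_0$ of $H$, the multigraph with vertex set $\{1,\ldots,r\}$ and edge multiset $\{\lambda_{F_i}(v_i)\lambda_{F_i}(v_{i+1}) : 0\le i<\ell\}$ is bridgeless. The chromatic number of a hypergraph is the least number of colours needed to colour its vertices so that no hyperedge is monochromatic. Distinct hyperedges $F_1,\ldots,F_\ell$ form a (Berge) cycle of length $\ell$ if there are distinct vertices $x_1,\ldots,x_\ell$ with $x_i\in F_i\cap F_{i+1}$ for all $i$ (indices mod $\ell$); the girth of a hypergraph is the length of its shortest Berge cycle. *)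

theory Defs
  imports Main "HOL-Library.Extended_Nat"
begin

definition hypergraph :: "'a set \<Rightarrow> 'a set set \<Rightarrow> bool" where
  "hypergraph V E \<longleftrightarrow> (\<forall>F\<in>E. F \<subseteq> V)"

definition uniform :: "nat \<Rightarrow> 'a set \<Rightarrow> 'a set set \<Rightarrow> bool" where
  "uniform r V E \<longleftrightarrow> hypergraph V E \<and> (\<forall>F\<in>E. finite F \<and> card F = r)"

definition closed_walk :: "'a set set \<Rightarrow> nat \<Rightarrow> (nat \<Rightarrow> 'a) \<Rightarrow> (nat \<Rightarrow> 'a set) \<Rightarrow> bool" where
  "closed_walk E l v F \<longleftrightarrow>
     (\<forall>i<l. F i \<in> E \<and> v i \<in> F i \<and> v (Suc i mod l) \<in> F i \<and> F i \<noteq> F (Suc i mod l))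
     \<and> inj_on v {1..<l}"

text \<open>Multigraphs given by a list of (possibly repeated, possibly loop) edges.
  Connectivity is the reflexive-transitive closure of the symmetric edge relation.
  An edge is a bridge if after deleting that single copy its ends are disconnected.\<close>

definition ugraph_rel :: "('b \<times> 'b) list \<Rightarrow> ('b \<times> 'b) set" where
  "ugraph_rel es = set es \<union> (set es)\<inverse>"

definition is_bridge :: "('b \<times> 'b) list \<Rightarrow> nat \<Rightarrow> bool" where
  "is_bridge es j \<longleftrightarrow> j < length es \<and>
     es ! j \<notin> (ugraph_rel (take j es @ drop (Suc j) es))\<^sup>*"

definition bridgeless :: "('b \<times> 'b) list \<Rightarrow> bool" where
  "bridgeless es \<longleftrightarrow> (\<forall>j. \<not> is_bridge es j)"

definition walk_multigraph ::
  "('a set \<Rightarrow> 'a \<Rightarrow> nat) \<Rightarrow> nat \<Rightarrow> (nat \<Rightarrow> 'a) \<Rightarrow> (nat \<Rightarrow> 'a set) \<Rightarrow> (nat \<times> nat) list" where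
  "walk_multigraph lab l v F = map (\<lambda>i. (lab (F i) (v i), lab (F i) (v (Suc i mod l)))) [0..<l]"

definition tranquil :: "nat \<Rightarrow> 'a set \<Rightarrow> 'a set set \<Rightarrow> bool" where
  "tranquil r V E \<longleftrightarrow>
     (\<exists>lab :: 'a set \<Rightarrow> 'a \<Rightarrow> nat.
        (\<forall>F\<in>E. bij_betw (lab F) F {1..r}) \<and>
        (\<forall>l v F. closed_walk E l v F \<longrightarrow> bridgeless (walk_multigraph lab l v F)))"

definition colourable :: "'a set \<Rightarrow> 'a set set \<Rightarrow> nat \<Rightarrow> bool" where
  "colourable V E m \<longleftrightarrow>
     (\<exists>c :: 'a \<Rightarrow> nat. (\<forall>x\<in>V. c x < m) \<and> (\<forall>F\<in>E. \<exists>x\<in>F. \<exists>y\<in>F. c x \<noteq> c y))"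

definition chromatic_number :: "'a set \<Rightarrow> 'a set set \<Rightarrow> nat" where
  "chromatic_number V E = (LEAST m. colourable V E m)"

definition berge_cycle :: "'a set set \<Rightarrow> nat \<Rightarrow> bool" where
  "berge_cycle E l \<longleftrightarrow> 2 \<le> l \<and>
     (\<exists>F :: nat \<Rightarrow> 'a set. \<exists>x :: nat \<Rightarrow> 'a.
        (\<forall>i<l. F i \<in> E) \<and> inj_on F {..<l} \<and> inj_on x {..<l} \<and>
        (\<forall>i<l. x i \<in> F i \<and> x i \<in> F (Suc i mod l)))"

text \<open>Girth: length of a shortest Berge cycle (infinity if there is none).\<close>

definition girth :: "'a set set \<Rightarrow> enat" where
  "girth E = (INF l \<in> {l. berge_cycle E l}. enat l)"

end

theory Submission
  imports Defs "HOL-Library.Nat_Bijection" "HOL-Library.FuncSet"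
begin

text \<open>
  Tranquility follows from a static condition: for every partition \<open>h\<close> of the labels there is a
  vertex function \<open>\<phi>\<close> which, on each hyperedge, identifies exactly the vertices whose labels lie in
  the same class of \<open>h\<close>. Indeed a bridge yields a cut of the labels crossed by exactly one step of
  the walk, so \<open>\<phi>\<close> would change exactly once around a closed walk.

  Disregarding girth, such hypergraphs of large chromatic number arise as iterated products with a
  large clique, one factor for each cut \<open>A\<close> of the labels: the new coordinate of a vertex of a
  hyperedge depends only on whether its label is in \<open>A\<close>, and two values with equal colouring
  behaviour exist by pigeonhole. The girth is then raised by the partite amalgamation of Nesetril
  and Roedl, which preserves the static condition: the partition that \<open>\<phi>\<close> induces on the amalgamated
  part is itself realised on the amalgamating hypergraph.
\<close>

section \<open>Labelled hypergraphs and the properties to be combined\<close>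

text \<open>
  A set \<open>L\<close> of functions encodes an \<open>r\<close>-uniform hypergraph with labelled hyperedges: \<open>e \<in> L\<close> stands
  for the hyperedge \<open>e ` {..<r}\<close> in which \<open>e i\<close> has label \<open>i\<close>; values of \<open>e\<close> beyond \<open>r\<close> are junk.
\<close>

definition separates ::
  "nat \<Rightarrow> (nat \<Rightarrow> nat) set \<Rightarrow> (nat \<Rightarrow> 'b) \<Rightarrow> (nat \<Rightarrow> nat) \<Rightarrow> bool" where
  "separates r L h \<phi> \<longleftrightarrow> (\<forall>e\<in>L. \<forall>i<r. \<forall>j<r. \<phi> (e i) = \<phi> (e j) \<longleftrightarrow> h i = h j)"

definition separating :: "nat \<Rightarrow> (nat \<Rightarrow> nat) set \<Rightarrow> bool" where
  "separating r L \<longleftrightarrow> (\<forall>h :: nat \<Rightarrow> nat. \<exists>\<phi>. separates r L h \<phi>)"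

text \<open>The bound \<open>q < k\<close> is stated separately so that it has content for
  \<open>r = 0\<close> too; the amalgamation meets this case when a part is empty.\<close>

definition unavoidable :: "nat \<Rightarrow> nat \<Rightarrow> (nat \<Rightarrow> nat) set \<Rightarrow> bool" where
  "unavoidable r k L \<longleftrightarrow> (\<forall>c :: nat \<Rightarrow> nat. (\<forall>v. c v < k) \<longrightarrow>
     (\<exists>e\<in>L. \<exists>q<k. \<forall>i<r. c (e i) = q))"

text \<open>Leaf elimination for hyperforests: \<open>e\<close> hangs on the roots \<open>R\<close>
  and on the rest of \<open>T\<close> by at most one vertex \<open>a\<close>.\<close>

definition leaf :: "nat \<Rightarrow> nat set \<Rightarrow> (nat \<Rightarrow> nat) set \<Rightarrow> (nat \<Rightarrow> nat) \<Rightarrow> bool" where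
  "leaf r R T e \<longleftrightarrow> 
     (\<exists>a. \<forall>i<r. e i \<in> R \<or> (\<exists>f\<in>T. f \<noteq> e \<and> (\<exists>j<r. e i = f j)) \<longrightarrow> e i = a)"

text \<open>Any at most \<open>s\<close> hyperedges form a Berge forest. The leaf formulation
  excludes short cycles and is the form that passes from the copies to an amalgam.\<close>

definition locally_acyclic :: "nat \<Rightarrow> nat \<Rightarrow> (nat \<Rightarrow> nat) set \<Rightarrow> bool" where
  "locally_acyclic r s L \<longleftrightarrow>
     (\<forall>T\<subseteq>L. T \<noteq> {} \<longrightarrow> finite T \<longrightarrow> card T \<le> s \<longrightarrow> (\<exists>e\<in>T. leaf r {} T e))"

lemma separatesI:
  assumes "\<And>e i j. e \<in> L \<Longrightarrow> i < r \<Longrightarrow> j < r \<Longrightarrow> \<phi> (e i) = \<phi> (e j) \<longleftrightarrow> h i = h j"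
  shows "separates r L h \<phi>"
  using assms by (simp add: separates_def)

lemma separatesD:
  assumes "separates r L h \<phi>" "e \<in> L" "i < r" "j < r"
  shows "\<phi> (e i) = \<phi> (e j) \<longleftrightarrow> h i = h j"
  using assms by (simp add: separates_def)

text \<open>The partition of the labels into singletons forces the vertices of a hyperedge to
  receive pairwise different values.\<close>

lemma separating_inj_on:
  assumes "separating r L" "e \<in> L"
  shows "inj_on e {..<r}"
proof -
  obtain \<phi> where "separates r L (\<lambda>i. i) \<phi>"
    using assms(1) unfolding separating_def by blast
  from separatesD[OF this assms(2)] show ?thesis by (metis inj_onI lessThan_iff)
qed

lemma leafD:
  assumes "leaf r R T e"
  shows "\<exists>a. \<forall>i<r. (e i \<in> R \<longrightarrow> e i = a) \<and> (\<forall>f\<in>T. f \<noteq> e \<longrightarrow> (\<forall>j<r. e i = f j \<longrightarrow> e i = a))"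
  using assms unfolding leaf_def by (elim ex_forward) blast

lemma leafI:
  assumes "\<And>i. i < r \<Longrightarrow> e i \<in> R \<Longrightarrow> e i = a"
    and "\<And>i f j. \<lbrakk>i < r; f \<in> T; f \<noteq> e; j < r; e i = f j\<rbrakk> \<Longrightarrow> e i = a"
  shows "leaf r R T e"
  unfolding leaf_def by (rule exI[of _ a]) (use assms in blast)

text \<open>
  If a leaf of \<open>T\<close> fails only because of the root \<open>x\<close>, delete it and use as new root the vertex at
  which it was attached.
\<close>

lemma rooted_leaf:
  assumes "finite T" "T \<noteq> {}"
    and "\<And>U. U \<subseteq> T \<Longrightarrow> U \<noteq> {} \<Longrightarrow> \<exists>e\<in>U. leaf r {} U e"
  shows "\<exists>e\<in>T. leaf r {x} T e"
  using assms
proof (induction "card T" arbitrary: T x rule: less_induct)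
  case less
  obtain e where e: "e \<in> T" "leaf r {} T e" using less.prems by blast
  obtain a where leaf_a: "\<forall>i<r. (e i \<in> {} \<longrightarrow> e i = a) \<and>
      (\<forall>f\<in>T. f \<noteq> e \<longrightarrow> (\<forall>j<r. e i = f j \<longrightarrow> e i = a))"
    using leafD[OF e(2)] by (rule exE)
  then have a: "e i = a" if "i < r" "f \<in> T" "f \<noteq> e" "j < r" "e i = f j" for i f j
    using that by blast
  show ?case
  proof (cases "leaf r {x} T e")
    case True
    then show ?thesis using e by blast
  next
    case False
    have "\<exists>i<r. e i = x \<and> x \<noteq> a"
    proof (rule ccontr)
      assume no: "\<not> (\<exists>i<r. e i = x \<and> x \<noteq> a)"
      have "leaf r {x} T e"
      proof (rule leafI[where a = a])
        show "e i = a" if "i < r" "e i \<in> {x}" for i using that no by auto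
      qed (rule a)
      then show False using False by blast
    qed
    then obtain i where i: "i < r" "e i = x" "x \<noteq> a" by blast
    have xo: "e' j \<noteq> x" if "e' \<in> T" "e' \<noteq> e" "j < r" for e' j
      using a[OF i(1) that] i by metis
    have "T - {e} \<noteq> {}"
    proof
      assume "T - {e} = {}"
      then have "leaf r {x} T e" by (intro leafI[where a = x]) auto
      then show False using False by blast
    qed
    moreover have "card (T - {e}) < card T" using e less.prems(1) by (meson card_Diff1_less)
    moreover have "finite (T - {e})" using less.prems(1) by blast
    moreover have "\<And>U. U \<subseteq> T - {e} \<Longrightarrow> U \<noteq> {} \<Longrightarrow> \<exists>e\<in>U. leaf r {} U e"
      using less.prems(3) by blast
    ultimately obtain e' where e': "e' \<in> T - {e}" "leaf r {a} (T - {e}) e'"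
      using less.hyps by meson
    obtain b where leaf_b: "\<forall>i<r. (e' i \<in> {a} \<longrightarrow> e' i = b) \<and>
        (\<forall>f\<in>T - {e}. f \<noteq> e' \<longrightarrow> (\<forall>j<r. e' i = f j \<longrightarrow> e' i = b))"
      using leafD[OF e'(2)] by (rule exE)
    then have b1: "e' i = b" if "i < r" "e' i = a" for i using that by simp
    have b2: "e' i = b" if "i < r" "f \<in> T - {e}" "f \<noteq> e'" "j < r" "e' i = f j" for i f j
      using leaf_b that by blast
    have "leaf r {x} T e'"
    proof (rule leafI[where a = b])
      show "e' i = b" if "i < r" "e' i \<in> {x}" for i using xo e' that by blast
      show "e' i = b" if "i < r" "f \<in> T" "f \<noteq> e'" "j < r" "e' i = f j" for i f j
      proof (cases "f = e")
        case True
        have "e j = a" using a[of j e' i] e' that True by auto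
        then show ?thesis using b1 that True by metis
      next
        case False
        then show ?thesis using b2[of i f j] that by blast
      qed
    qed
    then show ?thesis using e' by blast
  qed
qed

section \<open>Unavoidable separating systems without girth\<close>

text \<open>Each cut \<open>A\<close> costs one new coordinate, equal to \<open>y\<close> on labels
  in \<open>A\<close> and to \<open>y'\<close> on the others. Every slice with fixed
  \<open>y\<close> contains a monochromatic hyperedge; two slices with the same hyperedge and colour
  can be mixed. The cut \<open>A\<close> is read off the new coordinate, earlier cuts off the old
  one.\<close>

lemma unavoidable_cuts:
  assumes "finite \<A>"
  shows "\<exists>L. finite L \<and> unavoidable r k L \<and> (\<forall>A\<in>\<A>. \<exists>\<phi>. separates r L (\<lambda>i. i \<in> A) \<phi>)"
  using assms
proof induction
  case empty
  \<comment> \<open>A constant hyperedge may start the induction, since no cut has to be separated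
    yet.\<close>
  have "unavoidable r k {\<lambda>_. 0}" unfolding unavoidable_def by auto
  then show ?case by (intro exI[of _ "{\<lambda>_. 0}"]) simp
next
  case (insert A \<A>)
  then obtain L where L: "finite L" "unavoidable r k L"
    and cuts: "\<And>B. B \<in> \<A> \<Longrightarrow> \<exists>\<phi>. separates r L (\<lambda>i. i \<in> B) \<phi>"
    by blast
  \<comment> \<open>The slices \<open>0, ..., N\<close> outnumber the \<open>N\<close> pairs of a
    hyperedge and a colour.\<close>
  define N where "N = card L * k"
  define g where "g = (\<lambda>(e :: nat \<Rightarrow> nat, y, y') i. prod_encode (e i, if i \<in> A then y else y' :: nat))"
  define D where "D = {(y, y'). y \<le> N \<and> y' \<le> N \<and> y \<noteq> y'}"
  define L' where "L' = g ` (L \<times> D)"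
  have "finite D" by (rule finite_subset[of _ "{..N} \<times> {..N}"]) (auto simp: D_def)
  then have fin: "finite L'" using L by (simp add: L'_def)
  have una: "unavoidable r k L'"
    unfolding unavoidable_def
  proof (intro allI impI)
    fix c :: "nat \<Rightarrow> nat" assume c: "\<forall>v. c v < k"
    have "\<forall>y. \<exists>e q. e \<in> L \<and> q < k \<and> (\<forall>i<r. c (prod_encode (e i, y)) = q)"
    proof
      fix y
      show "\<exists>e q. e \<in> L \<and> q < k \<and> (\<forall>i<r. c (prod_encode (e i, y)) = q)"
        using L(2)[unfolded unavoidable_def, rule_format, of "\<lambda>v. c (prod_encode (v, y))"] c by blast
    qed
    then obtain E Q where EQ: "\<And>y. E y \<in> L" "\<And>y. Q y < k"
      "\<And>y i. i < r \<Longrightarrow> c (prod_encode (E y i, y)) = Q y" by metis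
    have "card ((\<lambda>y. (E y, Q y)) ` {..N}) \<le> card (L \<times> {..<k})"
      by (rule card_mono) (use L EQ in auto)
    then have "card ((\<lambda>y. (E y, Q y)) ` {..N}) < card {..N}" by (simp add: N_def card_cartesian_product)
    then have "\<not> inj_on (\<lambda>y. (E y, Q y)) {..N}" by (rule pigeonhole)
    then obtain y y' where y: "y \<le> N" "y' \<le> N" "y \<noteq> y'" "E y = E y'" "Q y = Q y'"
      unfolding inj_on_def by auto
    have "g (E y, y, y') \<in> L'" using EQ y by (auto simp: L'_def D_def)
    moreover have "\<forall>i<r. c (g (E y, y, y') i) = Q y" using EQ(3)[of _ y] EQ(3)[of _ y'] y by (simp add: g_def)
    ultimately show "\<exists>e\<in>L'. \<exists>q<k. \<forall>i<r. c (e i) = q" using EQ(2) by blast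
  qed
  have "\<exists>\<phi>. separates r L' (\<lambda>i. i \<in> B) \<phi>" if "B \<in> insert A \<A>" for B
  proof (cases "B = A")
    case True
    have "separates r L' (\<lambda>i. i \<in> B) (\<lambda>v. snd (prod_decode v))"
      by (rule separatesI) (auto simp: True L'_def g_def D_def split: if_splits)
    then show ?thesis by blast
  next
    case False
    then have "B \<in> \<A>" using that by simp
    then obtain \<phi> where \<phi>: "separates r L (\<lambda>i. i \<in> B) \<phi>"
      using cuts by blast
    have "separates r L' (\<lambda>i. i \<in> B) (\<lambda>v. \<phi> (fst (prod_decode v)))"
      by (rule separatesI) (auto simp: L'_def g_def separatesD[OF \<phi>])
    then show ?thesis by blast
  qed
  then show ?case using fin una by blast
qed

text \<open>Cuts suffice for arbitrary partitions: \<open>h\<close> is determined by the cuts of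
  labels \<open>i\<close> with \<open>h i = h a\<close>, one for each \<open>a < r\<close>, and the
  list of the functions separating them separates \<open>h\<close>.\<close>

lemma unavoidable_separating: "\<exists>L. finite L \<and> unavoidable r k L \<and> separating r L"
proof -
  obtain L where L: "finite L" "unavoidable r k L"
    and cuts: "\<And>A. A \<subseteq> {..<r} \<Longrightarrow> \<exists>\<phi>. separates r L (\<lambda>i. i \<in> A) \<phi>"
    using unavoidable_cuts[of "Pow {..<r}" r k] by auto
  have "\<exists>\<phi>. separates r L h \<phi>" for h :: "nat \<Rightarrow> nat"
  proof -
    have "\<forall>a. \<exists>\<phi>. separates r L (\<lambda>i. i \<in> {i\<in>{..<r}. h i = h a}) \<phi>"
      by (intro allI cuts) auto
    then obtain \<Phi> where \<Phi>: "\<And>a. separates r L (\<lambda>i. i \<in> {i\<in>{..<r}. h i = h a}) (\<Phi> a)"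
      by metis
    have "\<Phi> a (e i) = \<Phi> a (e j) \<longleftrightarrow> (h i = h a \<longleftrightarrow> h j = h a)"
      if "e \<in> L" "i < r" "j < r" for a e i j
      using separatesD[OF \<Phi> that, of a] that by simp
    then have "(\<forall>a<r. \<Phi> a (e i) = \<Phi> a (e j)) \<longleftrightarrow> h i = h j" if "e \<in> L" "i < r" "j < r" for e i j
      using that by metis
    then have "separates r L h (\<lambda>v. list_encode (map (\<lambda>a. \<Phi> a v) [0..<r]))"
      by (intro separatesI) (simp add: list_encode_eq Ball_def)
    then show ?thesis by blast
  qed
  then show ?thesis using L unfolding separating_def by blast
qed

section \<open>Amalgamation along one part\<close>

text \<open>
  In the amalgam, every hyperedge \<open>f\<close> of \<open>M\<close> carries a copy of \<open>P\<close> whose part \<open>X\<close> is identified with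
  the vertices of \<open>f\<close>. Vertices of \<open>M\<close> are tagged with \<open>0\<close>, private vertices of the copy with
  \<open>Suc (\<kappa> f)\<close>.
\<close>

definition copy_map ::
  "((nat \<Rightarrow> nat) \<Rightarrow> nat) \<Rightarrow> nat set \<Rightarrow> (nat \<Rightarrow> nat) \<Rightarrow> (nat \<Rightarrow> nat) \<Rightarrow> nat \<Rightarrow> nat" where
  "copy_map \<kappa> X idx f v =
     (if v \<in> X then prod_encode (0, f (idx v)) else prod_encode (Suc (\<kappa> f), v))"

definition amalgam ::
  "((nat \<Rightarrow> nat) \<Rightarrow> nat) \<Rightarrow> nat set \<Rightarrow> (nat \<Rightarrow> nat) \<Rightarrow> (nat \<Rightarrow> nat) set \<Rightarrow> (nat \<Rightarrow> nat) set
     \<Rightarrow> (nat \<Rightarrow> nat) set" where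
  "amalgam \<kappa> X idx M P = (\<lambda>(f, e). copy_map \<kappa> X idx f \<circ> e) ` (M \<times> P)"

lemma copy_map_eq_iff:
  assumes "inj_on \<kappa> M" "f \<in> M" "f' \<in> M"
  shows "copy_map \<kappa> X idx f u = copy_map \<kappa> X idx f' w \<longleftrightarrow>
    (u \<in> X \<and> w \<in> X \<and> f (idx u) = f' (idx w)) \<or> (u \<notin> X \<and> f = f' \<and> u = w)"
  using inj_on_eq_iff[OF assms] by (auto simp: copy_map_def)

text \<open>A function \<open>\<phi>\<close> for \<open>h\<close> on \<open>P\<close> partitions
  \<open>X\<close>, that is, the labels of \<open>M\<close>. As \<open>M\<close> is separating, one
  \<open>\<psi>\<close> realises this partition on all hyperedges of \<open>M\<close> at once, so
  the copies of \<open>\<phi>\<close> can be renamed to agree wherever they are glued.\<close>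

lemma separating_amalgam:
  assumes P: "separating r P" and M: "separating m M"
    and idx: "bij_betw idx X {..<m}" and \<kappa>: "inj_on \<kappa> M"
  shows "separating r (amalgam \<kappa> X idx M P)"
  unfolding separating_def
proof
  fix h :: "nat \<Rightarrow> nat"
  obtain \<phi> where \<phi>: "separates r P h \<phi>"
    using P unfolding separating_def by blast
  obtain \<psi> where \<psi>: "separates m M (\<lambda>s. \<phi> (inv_into X idx s)) \<psi>"
    using M unfolding separating_def by blast
  have \<psi>X: "\<psi> (f (idx u)) = \<psi> (f (idx w)) \<longleftrightarrow> \<phi> u = \<phi> w" if "f \<in> M" "u \<in> X" "w \<in> X" for f u w
  proof -
    have "idx u < m" "idx w < m" using idx that by (auto dest: bij_betwE)
    then have "\<psi> (f (idx u)) = \<psi> (f (idx w)) \<longleftrightarrow>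
        \<phi> (inv_into X idx (idx u)) = \<phi> (inv_into X idx (idx w))"
      using separatesD[OF \<psi> that(1)] by blast
    then show ?thesis using idx that by (simp add: bij_betw_inv_into_left)
  qed
  \<comment> \<open>A class of \<open>\<phi>\<close> meeting \<open>X\<close> is named by
    \<open>\<psi>\<close> at a representative in \<open>X\<close>, also for its members outside
    \<open>X\<close>; any other class is private to its copy. The tags \<open>0\<close> and
    \<open>Suc\<close> keep the two kinds apart.\<close>
  define \<alpha> where "\<alpha> f v = (if \<exists>u\<in>X. \<phi> u = \<phi> v
      then prod_encode (0, \<psi> (f (idx (SOME u. u \<in> X \<and> \<phi> u = \<phi> v))))
      else prod_encode (Suc (\<kappa> f), \<phi> v))" for f v
  have \<alpha>X: "\<alpha> f v = prod_encode (0, \<psi> (f (idx u)))" if "f \<in> M" "u \<in> X" "\<phi> u = \<phi> v" for f u v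
  proof -
    have "(SOME u. u \<in> X \<and> \<phi> u = \<phi> v) \<in> X \<and> \<phi> (SOME u. u \<in> X \<and> \<phi> u = \<phi> v) = \<phi> v"
      by (rule someI[of _ u]) (use that in simp)
    then have "\<psi> (f (idx (SOME u. u \<in> X \<and> \<phi> u = \<phi> v))) = \<psi> (f (idx u))"
      using \<psi>X that by simp
    then show ?thesis using that by (auto simp: \<alpha>_def)
  qed
  have \<alpha>N: "\<alpha> f v = prod_encode (Suc (\<kappa> f), \<phi> v)" if "\<not> (\<exists>u\<in>X. \<phi> u = \<phi> v)" for f v
    using that by (auto simp: \<alpha>_def)
  have \<alpha>_iff: "\<alpha> f u = \<alpha> f w \<longleftrightarrow> \<phi> u = \<phi> w" if f: "f \<in> M" for f u w
  proof (cases "\<exists>x\<in>X. \<phi> x = \<phi> u")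
    case u: True
    then obtain x where x: "x \<in> X" "\<phi> x = \<phi> u" by blast
    show ?thesis
    proof (cases "\<exists>y\<in>X. \<phi> y = \<phi> w")
      case True
      then obtain y where "y \<in> X" "\<phi> y = \<phi> w" by blast
      then show ?thesis using \<alpha>X[OF f] \<psi>X[OF f] x by simp
    next
      case False
      then show ?thesis using \<alpha>X[OF f] \<alpha>N[OF False, of f] x by auto
    qed
  next
    case u: False
    show ?thesis
    proof (cases "\<exists>y\<in>X. \<phi> y = \<phi> w")
      case True
      then obtain y where "y \<in> X" "\<phi> y = \<phi> w" by blast
      then show ?thesis using \<alpha>X[OF f] \<alpha>N[OF u, of f] u by auto
    next
      case False
      then show ?thesis using \<alpha>N[OF u, of f] \<alpha>N[OF False, of f] by simp
    qed
  qed
  have wd: "\<alpha> f u = \<alpha> f' w"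
    if M: "f \<in> M" "f' \<in> M" and eq: "copy_map \<kappa> X idx f u = copy_map \<kappa> X idx f' w"
    for f f' u w
  proof -
    consider "u \<in> X" "w \<in> X" "f (idx u) = f' (idx w)" | "f = f'" "u = w"
      using eq copy_map_eq_iff[OF \<kappa> M, of X idx u w] by blast
    then show ?thesis
    proof cases
      case 1
      then show ?thesis using \<alpha>X[OF M(1) 1(1)] \<alpha>X[OF M(2) 1(2)] by simp
    qed simp
  qed
  \<comment> \<open>By \<open>wd\<close>, the value of \<open>\<alpha>\<close> depends only on the
    vertex of the amalgam and not on the copy through which it is seen.\<close>
  define \<chi> where "\<chi> z = (SOME y. \<exists>f\<in>M. \<exists>u. z = copy_map \<kappa> X idx f u \<and> y = \<alpha> f u)" for z
  have \<chi>: "\<chi> (copy_map \<kappa> X idx f u) = \<alpha> f u" if "f \<in> M" for f u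
    unfolding \<chi>_def
  proof (rule some_equality)
    show "\<exists>f'\<in>M. \<exists>w. copy_map \<kappa> X idx f u = copy_map \<kappa> X idx f' w \<and> \<alpha> f u = \<alpha> f' w"
      using that by blast
    show "y = \<alpha> f u"
      if "\<exists>f'\<in>M. \<exists>w. copy_map \<kappa> X idx f u = copy_map \<kappa> X idx f' w \<and> y = \<alpha> f' w" for y
      using that wd[OF \<open>f \<in> M\<close>] by metis
  qed
  have "separates r (amalgam \<kappa> X idx M P) h \<chi>"
    by (rule separatesI) (auto simp: amalgam_def \<chi> \<alpha>_iff separatesD[OF \<phi>])
  then show "\<exists>\<chi>. separates r (amalgam \<kappa> X idx M P) h \<chi>" by blast
qed

text \<open>
  If all hyperedges of \<open>T\<close> lie in different copies, any of them is a leaf. Otherwise fewer copies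
  than hyperedges are involved, so \<open>M\<close> has a leaf among them, and that copy is rooted at the vertex
  where it is attached.
\<close>

lemma locally_acyclic_amalgam:
  assumes P: "locally_acyclic r (Suc s) P" and M: "locally_acyclic m s M" "separating m M"
    and idx: "bij_betw idx X {..<m}" and \<kappa>: "inj_on \<kappa> M"
    and X: "\<And>e. e \<in> P \<Longrightarrow> \<exists>a. \<forall>i<r. e i \<in> X \<longrightarrow> e i = a"
  shows "locally_acyclic r (Suc s) (amalgam \<kappa> X idx M P)"
  unfolding locally_acyclic_def
proof (intro allI impI)
  fix T assume T: "T \<subseteq> amalgam \<kappa> X idx M P" "T \<noteq> {}" "finite T" "card T \<le> Suc s"
  define g where "g = (\<lambda>(f, e :: nat \<Rightarrow> nat). copy_map \<kappa> X idx f \<circ> e)"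
  \<comment> \<open>One pair is chosen for each hyperedge of \<open>T\<close>, so that
    \<open>S\<close> and \<open>T\<close> have equal size.\<close>
  obtain S where S: "S \<subseteq> M \<times> P" "inj_on g S" "T = g ` S"
    using T(1) unfolding amalgam_def g_def[symmetric] by (auto simp: subset_image_inj)
  have finS: "finite S" using T(3) S finite_imageD by blast
  have cardS: "card S \<le> Suc s" using T(4) S by (simp add: card_image)
  have S0: "S \<noteq> {}" using T(2) S by blast
  have idx_less: "idx x < m" if "x \<in> X" for x using idx that by (auto dest: bij_betwE)
  have f_idx_inj: "u = w" if "f \<in> M" "u \<in> X" "w \<in> X" "f (idx u) = f (idx w)" for f u w
    using separating_inj_on[OF M(2) that(1)] idx that idx_less
    by (metis bij_betw_def inj_on_def lessThan_iff)
  show "\<exists>e\<in>T. leaf r {} T e"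
  proof (cases "inj_on fst S")
    case True
    obtain f e where fe: "(f, e) \<in> S" using S0 by auto
    then have MP: "f \<in> M" "e \<in> P" using S(1) by auto
    \<comment> \<open>Different copies share only vertices coming from \<open>X\<close>, and
      \<open>e\<close> has at most one of these.\<close>
    obtain a where a: "\<forall>i<r. e i \<in> X \<longrightarrow> e i = a" using X MP by blast
    have key: "g (f, e) i = copy_map \<kappa> X idx f a"
      if i: "i < r" and mem: "f0 \<in> T" "f0 \<noteq> g (f, e)" "j < r" "g (f, e) i = f0 j" for i f0 j
    proof -
      obtain f' e' where o: "(f', e') \<in> S" "g (f', e') \<noteq> g (f, e)" "g (f, e) i = g (f', e') j"
        using mem S(3) by auto
      have "f' \<noteq> f" using o fe True unfolding inj_on_def by fastforce
      moreover have "f' \<in> M" using o S(1) by auto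
      moreover have "copy_map \<kappa> X idx f (e i) = copy_map \<kappa> X idx f' (e' j)"
        using o(3) by (simp add: g_def)
      ultimately have "e i \<in> X"
        using copy_map_eq_iff[OF \<kappa> MP(1), of f' X idx "e i" "e' j"] by auto
      then show ?thesis using a i by (simp add: g_def)
    qed
    have "leaf r {} T (g (f, e))"
      by (rule leafI[where a = "copy_map \<kappa> X idx f a"]) (use key in blast)+
    then show ?thesis using fe S(3) by blast
  next
    case False
    define K where "K = fst ` S"
    \<comment> \<open>The strict inequality is why local acyclicity of \<open>M\<close> up to
      \<open>s\<close> suffices for the amalgam up to \<open>Suc s\<close>.\<close>
    have "card K < card S"
      unfolding K_def using False finS by (metis card_image_le eq_card_imp_inj_on le_neq_implies_less)
    then have "card K \<le> s" using cardS by linarith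
    moreover have "K \<subseteq> M" "K \<noteq> {}" "finite K" using S(1) S0 finS by (auto simp: K_def)
    ultimately obtain f where f: "f \<in> K" "leaf m {} K f"
      using M(1) unfolding locally_acyclic_def by blast
    then have fM: "f \<in> M" using \<open>K \<subseteq> M\<close> by blast
    obtain u where "\<forall>t<m. (f t \<in> {} \<longrightarrow> f t = u) \<and>
        (\<forall>f'\<in>K. f' \<noteq> f \<longrightarrow> (\<forall>t'<m. f t = f' t' \<longrightarrow> f t = u))"
      using leafD[OF f(2)] by (rule exE)
    then have u: "f t = u" if "t < m" "f' \<in> K" "f' \<noteq> f" "t' < m" "f t = f' t'" for t f' t'
      using that by blast
    \<comment> \<open>\<open>x\<close> is the vertex of \<open>P\<close> glued to the attachment
      vertex \<open>u\<close>. If no vertex of \<open>X\<close> goes to \<open>u\<close>, it is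
      arbitrary, and an additional root does no harm.\<close>
    define x where "x = (SOME w. w \<in> X \<and> f (idx w) = u)"
    have x: "x = w" if "w \<in> X" "f (idx w) = u" for w
      unfolding x_def by (rule some_equality) (use that f_idx_inj fM in auto)
    define T' where "T' = {e. (f, e) \<in> S}"
    have img: "Pair f ` T' \<subseteq> S" by (auto simp: T'_def)
    have finT': "finite T'"
      using finite_subset[OF img finS] by (rule finite_imageD) (simp add: inj_on_def)
    have "card T' = card (Pair f ` T')" by (simp add: card_image inj_on_def)
    also have "\<dots> \<le> card S" using img finS by (rule card_mono[rotated])
    finally have cardT': "card T' \<le> Suc s" using cardS by linarith
    have T'P: "T' \<subseteq> P" using S(1) by (auto simp: T'_def)
    have "T' \<noteq> {}" using f(1) by (auto simp: T'_def K_def)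
    moreover have "\<exists>e\<in>U. leaf r {} U e" if "U \<subseteq> T'" "U \<noteq> {}" for U
    proof -
      have "card U \<le> Suc s" using card_mono[OF finT' that(1)] cardT' by linarith
      moreover have "finite U" "U \<subseteq> P" using that finT' T'P finite_subset by auto
      ultimately show ?thesis using P that unfolding locally_acyclic_def by blast
    qed
    ultimately obtain e where e: "e \<in> T'" "leaf r {x} T' e"
      using rooted_leaf[OF finT', of r x] by blast
    obtain a where leaf_a: "\<forall>i<r. (e i \<in> {x} \<longrightarrow> e i = a) \<and>
        (\<forall>e'\<in>T'. e' \<noteq> e \<longrightarrow> (\<forall>j<r. e i = e' j \<longrightarrow> e i = a))"
      using leafD[OF e(2)] by (rule exE)
    then have a1: "e i = a" if "i < r" "e i = x" for i using that by simp
    have a2: "e i = a" if "i < r" "e' \<in> T'" "e' \<noteq> e" "j < r" "e i = e' j" for i e' j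
      using leaf_a that by blast
    have fe: "(f, e) \<in> S" using e by (simp add: T'_def)
    have key: "g (f, e) i = copy_map \<kappa> X idx f a"
      if i: "i < r" and mem: "f0 \<in> T" "f0 \<noteq> g (f, e)" "j < r" "g (f, e) i = f0 j" for i f0 j
    proof -
      obtain f' e' where o: "(f', e') \<in> S" "g (f', e') \<noteq> g (f, e)" "g (f, e) i = g (f', e') j"
        using mem S(3) by auto
      have f': "f' \<in> M" "f' \<in> K" using o S(1) by (auto simp: K_def image_iff intro: bexI[OF _ o(1)])
      have "copy_map \<kappa> X idx f (e i) = copy_map \<kappa> X idx f' (e' j)"
        using o(3) by (simp add: g_def)
      then have "(e i \<in> X \<and> e' j \<in> X \<and> f (idx (e i)) = f' (idx (e' j))) \<or> (f = f' \<and> e i = e' j)"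
        using copy_map_eq_iff[OF \<kappa> fM f'(1)] by blast
      then have "e i = a"
      \<comment> \<open>Within the copy, the vertex is shared with another hyperedge of
        \<open>T'\<close>; across copies it is glued at \<open>u\<close>, hence equals the root
        \<open>x\<close>.\<close>
      proof (cases "f' = f")
        case True
        then have "e i = e' j"
          using \<open>_ \<or> _\<close> f_idx_inj fM by blast
        moreover have "e' \<in> T'" "e' \<noteq> e" using o True by (auto simp: T'_def)
        ultimately show ?thesis using a2[OF i _ _ mem(3)] by blast
      next
        case False
        then have q: "e i \<in> X" "e' j \<in> X" "f (idx (e i)) = f' (idx (e' j))"
          using \<open>_ \<or> _\<close> by auto
        then have "f (idx (e i)) = u" using u[of "idx (e i)" f' "idx (e' j)"] idx_less f' False by blast
        then show ?thesis using x[of "e i"] a1 i q by simp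
      qed
      then show ?thesis by (simp add: g_def)
    qed
    have "leaf r {} T (g (f, e))"
      by (rule leafI[where a = "copy_map \<kappa> X idx f a"]) (use key in blast)+
    then show ?thesis using fe S(3) by blast
  qed
qed

section \<open>The partite construction\<close>

text \<open>Pairwise disjoint hyperedges do: one over each \<open>r\<close>-set \<open>R\<close> of
  parts, with vertices tagged by the code of \<open>R\<close>. Disjointness lets any
  \<open>h\<close> be copied onto the vertices and makes every hyperedge a leaf.\<close>

lemma partite_base:
  fixes r s a :: nat
  shows "\<exists>P (\<pi> :: nat \<Rightarrow> nat). finite P \<and> separating r P \<and> locally_acyclic r s P \<and>
    (\<forall>e\<in>P. inj_on (\<pi> \<circ> e) {..<r}) \<and>
    (\<forall>R\<subseteq>{..<a}. card R = r \<longrightarrow> (\<exists>e\<in>P. (\<pi> \<circ> e) ` {..<r} = R))"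
proof -
  define \<R> where "\<R> = {R. R \<subseteq> {..<a} \<and> card R = r}"
  have fin: "finite R" if "R \<in> \<R>" for R
    using that by (auto simp: \<R>_def intro: finite_subset[of R "{..<a}"])
  have "\<exists>b. bij_betw b {..<r} R" if "R \<in> \<R>" for R
    using ex_bij_betw_nat_finite[OF fin[OF that]] that by (auto simp: \<R>_def atLeast0LessThan)
  then obtain b where b: "\<And>R. R \<in> \<R> \<Longrightarrow> bij_betw (b R) {..<r} R" by metis
  define E where "E R = (\<lambda>i. prod_encode (set_encode R, b R i))" for R
  define P where "P = E ` \<R>"
  define \<pi> where "\<pi> v = snd (prod_decode v)" for v
  have \<pi>E: "\<pi> \<circ> E R = b R" for R by (auto simp: \<pi>_def E_def)
  have E_eq: "R = R' \<and> i = j" if "E R i = E R' j" "R \<in> \<R>" "R' \<in> \<R>" "i < r" "j < r" for R R' i j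
  proof -
    have enc: "set_encode R = set_encode R'" and bb: "b R i = b R' j"
      using that(1) by (simp_all add: E_def)
    have "R = R'"
      using arg_cong[OF enc, of set_decode] fin that(2,3) by (simp only: set_encode_inverse)
    moreover have "inj_on (b R) {..<r}" using b[OF that(2)] by (simp add: bij_betw_def)
    ultimately show ?thesis using bb that(4,5) by (simp add: inj_on_eq_iff)
  qed
  have "finite \<R>" by (rule finite_subset[of _ "Pow {..<a}"]) (auto simp: \<R>_def)
  then have "finite P" by (simp add: P_def)
  moreover have "separating r P"
    unfolding separating_def
  proof
    fix h :: "nat \<Rightarrow> nat"
    define \<phi> where "\<phi> z = (SOME y. \<exists>R\<in>\<R>. \<exists>i<r. z = E R i \<and> y = h i)" for z
    have "\<phi> (E R i) = h i" if Ri: "R \<in> \<R>" "i < r" for R i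
      unfolding \<phi>_def
    proof (rule some_equality)
      show "\<exists>R'\<in>\<R>. \<exists>j<r. E R i = E R' j \<and> h i = h j" using Ri by blast
      fix y assume "\<exists>R'\<in>\<R>. \<exists>j<r. E R i = E R' j \<and> y = h j"
      then obtain R' j where "R' \<in> \<R>" "j < r" "E R i = E R' j" "y = h j" by blast
      then show "y = h i" using E_eq[of R i R' j] Ri by simp
    qed
    then have "separates r P h \<phi>" by (intro separatesI) (auto simp: P_def)
    then show "\<exists>\<phi>. separates r P h \<phi>" by blast
  qed
  moreover have "locally_acyclic r s P"
    unfolding locally_acyclic_def
  proof (intro allI impI)
    fix T assume T: "T \<subseteq> P" "T \<noteq> {}"
    then obtain e where e: "e \<in> T" by blast
    have "leaf r {} T e"
    proof (rule leafI[where a = 0])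
      fix i f j assume f: "i < r" "f \<in> T" "f \<noteq> e" "j < r" "e i = f j"
      obtain R R' where "R \<in> \<R>" "R' \<in> \<R>" "e = E R" "f = E R'"
        using T(1) e f(2) unfolding P_def by blast
      then show "e i = 0" using E_eq[of R i R' j] f by auto
    qed simp
    then show "\<exists>e\<in>T. leaf r {} T e" using e by blast
  qed
  moreover have "\<forall>e\<in>P. inj_on (\<pi> \<circ> e) {..<r}"
    using b by (auto simp: P_def \<pi>E bij_betw_def)
  moreover have "\<forall>R\<subseteq>{..<a}. card R = r \<longrightarrow> (\<exists>e\<in>P. (\<pi> \<circ> e) ` {..<r} = R)"
  proof (intro allI impI)
    fix R assume "R \<subseteq> {..<a}" "card R = r"
    then have "R \<in> \<R>" by (simp add: \<R>_def)
    then show "\<exists>e\<in>P. (\<pi> \<circ> e) ` {..<r} = R"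
      by (intro bexI[of _ "E R"]) (use b in \<open>auto simp: P_def \<pi>E bij_betw_def\<close>)
  qed
  ultimately show ?thesis by blast
qed

text \<open>
  Invariant of the amalgamation: \<open>\<pi>\<close> assigns vertices to parts, and every colouring has a
  subsystem, with a hyperedge over each \<open>r\<close>-set of parts, on which the first \<open>n\<close> parts are
  monochromatic.
\<close>

definition focused ::
  "nat \<Rightarrow> nat \<Rightarrow> nat \<Rightarrow> nat \<Rightarrow> (nat \<Rightarrow> nat) \<Rightarrow> (nat \<Rightarrow> nat) set \<Rightarrow> bool" where
  "focused r k a n \<pi> P \<longleftrightarrow>
     (\<forall>c. (\<forall>v. c v < k) \<longrightarrow> (\<exists>\<gamma>. (\<forall>p<n. \<gamma> p < k) \<and>
        (\<forall>R\<subseteq>{..<a}. card R = r \<longrightarrow> (\<exists>e\<in>P. (\<pi> \<circ> e) ` {..<r} = R \<and>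
           (\<forall>j<r. \<pi> (e j) < n \<longrightarrow> c (e j) = \<gamma> (\<pi> (e j)))))))"

lemma focusedD:
  assumes "focused r k a n \<pi> P" "\<forall>v. c v < k"
  shows "\<exists>\<gamma>. (\<forall>p<n. \<gamma> p < k) \<and>
    (\<forall>R\<subseteq>{..<a}. card R = r \<longrightarrow> (\<exists>e\<in>P. (\<pi> \<circ> e) ` {..<r} = R \<and>
       (\<forall>j<r. \<pi> (e j) < n \<longrightarrow> c (e j) = \<gamma> (\<pi> (e j)))))"
  using assms unfolding focused_def by (elim allE[of _ c]) (rule mp)

text \<open>Part \<open>n\<close> is handled by amalgamating along it with a system \<open>M\<close>
  whose hyperedges have the size of that part. A monochromatic hyperedge of \<open>M\<close> carries
  a copy of \<open>P\<close> with part \<open>n\<close> monochromatic, and inside that copy the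
  earlier parts are handled by induction.\<close>

lemma partite_amalgamation:
  fixes r s k n a :: nat
  assumes IH: "\<And>m. \<exists>M. finite M \<and> separating m M \<and> unavoidable m k M \<and> locally_acyclic m s M"
  shows "\<exists>P (\<pi> :: nat \<Rightarrow> nat). finite P \<and> separating r P \<and> locally_acyclic r (Suc s) P \<and>
    (\<forall>e\<in>P. inj_on (\<pi> \<circ> e) {..<r}) \<and>
    focused r k a n \<pi> P"
proof (induction n)
  case 0
  obtain P and \<pi> :: "nat \<Rightarrow> nat" where P: "finite P" "separating r P" "locally_acyclic r (Suc s) P"
      "\<forall>e\<in>P. inj_on (\<pi> \<circ> e) {..<r}"
    and all: "\<forall>R\<subseteq>{..<a}. card R = r \<longrightarrow> (\<exists>e\<in>P. (\<pi> \<circ> e) ` {..<r} = R)"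
    using partite_base[of r "Suc s" a] by (elim exE conjE)
  have "focused r k a 0 \<pi> P" using all unfolding focused_def by simp
  then show ?case using P by blast
next
  case (Suc n)
  then obtain P \<pi> where P: "finite P" "separating r P" "locally_acyclic r (Suc s) P"
    and trans: "\<And>e. e \<in> P \<Longrightarrow> inj_on (\<pi> \<circ> e) {..<r}"
    and foc: "focused r k a n \<pi> P"
    by blast
  define X where "X = {v \<in> (\<Union>e\<in>P. e ` {..<r}). \<pi> v = n}"
  have "finite X" using P(1) by (simp add: X_def)
  define m where "m = card X"
  obtain idx where idx: "bij_betw idx X {..<m}"
    using ex_bij_betw_finite_nat[OF \<open>finite X\<close>] by (auto simp: m_def atLeast0LessThan)
  obtain M where M: "finite M" "separating m M" "unavoidable m k M" "locally_acyclic m s M"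
    using IH by blast
  obtain \<kappa> :: "(nat \<Rightarrow> nat) \<Rightarrow> nat" where \<kappa>: "inj_on \<kappa> M"
    using finite_imp_inj_to_nat_seg[OF M(1)] by blast
  let ?\<iota> = "copy_map \<kappa> X idx"
  let ?P = "amalgam \<kappa> X idx M P"
  \<comment> \<open>Vertices tagged \<open>0\<close> come from \<open>M\<close> and all lie in part
    \<open>n\<close>; private vertices keep their part.\<close>
  define \<rho> where "\<rho> z = (if fst (prod_decode z) = 0 then n else \<pi> (snd (prod_decode z)))" for z
  have \<rho>: "\<rho> (?\<iota> f v) = \<pi> v" for f v by (auto simp: \<rho>_def copy_map_def X_def)
  have "finite ?P" using M(1) P(1) by (simp add: amalgam_def)
  moreover have "separating r ?P" using separating_amalgam[OF P(2) M(2) idx \<kappa>] .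
  moreover have "locally_acyclic r (Suc s) ?P"
  proof (rule locally_acyclic_amalgam[OF P(3) M(4,2) idx \<kappa>])
    fix e assume e: "e \<in> P"
    have "i = j" if "i < r" "j < r" "e i \<in> X" "e j \<in> X" for i j
      using trans[OF e] that by (auto simp: X_def inj_on_def)
    then show "\<exists>a. \<forall>i<r. e i \<in> X \<longrightarrow> e i = a" by metis
  qed
  moreover have "\<forall>e\<in>?P. inj_on (\<rho> \<circ> e) {..<r}"
    using trans by (auto simp: amalgam_def \<rho> inj_on_def)
  moreover have "focused r k a (Suc n) \<rho> ?P"
    unfolding focused_def
  proof (intro allI impI)
    fix c :: "nat \<Rightarrow> nat" assume c: "\<forall>v. c v < k"
    obtain f q where f: "f \<in> M" "q < k" "\<And>t. t < m \<Longrightarrow> c (prod_encode (0, f t)) = q"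
      using M(3)[unfolded unavoidable_def, rule_format, of "\<lambda>v. c (prod_encode (0, v))"] c by blast
    have cX: "c (?\<iota> f v) = q" if "v \<in> X" for v
      using f(3)[of "idx v"] that idx by (auto simp: copy_map_def dest: bij_betwE)
    \<comment> \<open>The colouring is pulled back to \<open>P\<close> along the copy at
      \<open>f\<close>, where \<open>X\<close> already has the single colour
      \<open>q\<close>.\<close>
    have c': "\<forall>v. c (?\<iota> f v) < k" using c by blast
    obtain \<gamma> where \<gamma>: "\<forall>p<n. \<gamma> p < k"
      and ex: "\<forall>R\<subseteq>{..<a}. card R = r \<longrightarrow> (\<exists>e\<in>P. (\<pi> \<circ> e) ` {..<r} = R \<and>
         (\<forall>j<r. \<pi> (e j) < n \<longrightarrow> c (?\<iota> f (e j)) = \<gamma> (\<pi> (e j))))"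
      using focusedD[OF foc c'] by (elim exE conjE)
    have "\<exists>e\<in>?P. (\<rho> \<circ> e) ` {..<r} = R \<and>
         (\<forall>j<r. \<rho> (e j) < Suc n \<longrightarrow> c (e j) = (\<gamma>(n := q)) (\<rho> (e j)))"
      if R: "R \<subseteq> {..<a}" "card R = r" for R
    proof -
      obtain e where e: "e \<in> P" "(\<pi> \<circ> e) ` {..<r} = R"
        "\<forall>j<r. \<pi> (e j) < n \<longrightarrow> c (?\<iota> f (e j)) = \<gamma> (\<pi> (e j))"
        using ex R by (elim allE[of _ R]) blast
      have "c (?\<iota> f (e j)) = (\<gamma>(n := q)) (\<pi> (e j))" if "j < r" "\<pi> (e j) < Suc n" for j
      proof (cases "\<pi> (e j) = n")
        case True
        then have "e j \<in> X" using e(1) that by (auto simp: X_def)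
        then show ?thesis using cX True by simp
      next
        case False
        then show ?thesis using e(3) that by simp
      qed
      moreover have "?\<iota> f \<circ> e \<in> ?P"
        unfolding amalgam_def by (rule image_eqI[of _ _ "(f, e)"]) (use f e in auto)
      moreover have "(\<rho> \<circ> (?\<iota> f \<circ> e)) ` {..<r} = R" using e(2) by (simp add: o_def \<rho>)
      ultimately show ?thesis by (intro bexI[of _ "?\<iota> f \<circ> e"]) (auto simp: \<rho>)
    qed
    moreover have "\<forall>p<Suc n. (\<gamma>(n := q)) p < k" using \<gamma> f(2) by (auto simp: less_Suc_eq)
    ultimately show "\<exists>\<gamma>. (\<forall>p<Suc n. \<gamma> p < k) \<and>
      (\<forall>R\<subseteq>{..<a}. card R = r \<longrightarrow> (\<exists>e\<in>?P. (\<rho> \<circ> e) ` {..<r} = R \<and>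
         (\<forall>j<r. \<rho> (e j) < Suc n \<longrightarrow> c (e j) = \<gamma> (\<rho> (e j)))))"
      by (intro exI[of _ "\<gamma>(n := q)"]) simp
  qed
  ultimately show ?case by blast
qed

text \<open>The induction on \<open>s\<close> keeps \<open>r\<close> arbitrary because the systems
  used in the amalgamation have hyperedges of the size of a whole part.\<close>

lemma unavoidable_separating_locally_acyclic:
  "\<exists>L. finite L \<and> separating r L \<and> unavoidable r k L \<and> locally_acyclic r s L"
proof (induction s arbitrary: r)
  case 0
  obtain L where "finite L" "unavoidable r k L" "separating r L"
    using unavoidable_separating by blast
  moreover have "locally_acyclic r 0 L" by (auto simp: locally_acyclic_def)
  ultimately show ?case by blast
next
  case (Suc s)
  \<comment> \<open>Among \<open>r * k\<close> parts, each with one of \<open>k\<close> colours,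
    some \<open>r\<close> share their colour.\<close>
  define a where "a = r * k"
  obtain P \<pi> where P: "finite P" "separating r P" "locally_acyclic r (Suc s) P"
    and foc: "focused r k a a \<pi> P"
    using partite_amalgamation[OF Suc.IH, where n = a and a = a and r = r] by blast
  have "unavoidable r k P"
    unfolding unavoidable_def
  proof (intro allI impI)
    fix c :: "nat \<Rightarrow> nat" assume c: "\<forall>v. c v < k"
    then have "0 < k" by (metis less_nat_zero_code not_gr_zero)
    obtain \<gamma> where \<gamma>: "\<forall>p<a. \<gamma> p < k"
      and ex: "\<forall>R\<subseteq>{..<a}. card R = r \<longrightarrow> (\<exists>e\<in>P. (\<pi> \<circ> e) ` {..<r} = R \<and>
         (\<forall>j<r. \<pi> (e j) < a \<longrightarrow> c (e j) = \<gamma> (\<pi> (e j))))"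
      using focusedD[OF foc c] by (elim exE conjE)
    obtain q where q: "q < k" "card {..<a} \<le> card (\<gamma> -` {q} \<inter> {..<a}) * card {..<k}"
      using pigeonhole_card[of \<gamma> "{..<a}" "{..<k}"] \<gamma> \<open>0 < k\<close> by auto
    then have "r \<le> card (\<gamma> -` {q} \<inter> {..<a})" using \<open>0 < k\<close> by (simp add: a_def)
    then obtain R where R: "R \<subseteq> \<gamma> -` {q} \<inter> {..<a}" "card R = r"
      by (meson obtain_subset_with_card_n)
    then obtain e where e: "e \<in> P" "(\<pi> \<circ> e) ` {..<r} = R"
      "\<forall>j<r. \<pi> (e j) < a \<longrightarrow> c (e j) = \<gamma> (\<pi> (e j))"
      using ex by (elim allE[of _ R]) blast
    have "c (e j) = q" if "j < r" for j
    proof -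
      have "\<pi> (e j) \<in> R" using e(2) that by auto
      then show ?thesis using e(3) that R(1) by auto
    qed
    then show "\<exists>e\<in>P. \<exists>q<k. \<forall>i<r. c (e i) = q" using e(1) q(1) by blast
  qed
  then show ?case using P by blast
qed

section \<open>Tranquility from separation\<close>

lemma cyclic_chain:
  assumes "j < l" and "\<And>i. i < l \<Longrightarrow> i \<noteq> j \<Longrightarrow> \<phi> i = \<phi> (Suc i mod l)"
  shows "\<phi> (Suc j mod l) = \<phi> j"
proof -
  have "\<phi> ((Suc j + n) mod l) = \<phi> (Suc j mod l)" if "n < l" for n
    using that
  proof (induction n)
    case (Suc n)
    let ?i = "(Suc j + n) mod l"
    have "?i \<noteq> j"
    proof
      assume "?i = j"
      then have "(j + Suc n) mod l = j mod l" using assms(1) by simp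
      then have "l dvd Suc n" by (simp add: mod_eq_dvd_iff_nat)
      then show False using Suc.prems by (auto dest: dvd_imp_le)
    qed
    then have "\<phi> ?i = \<phi> (Suc ?i mod l)" using assms by simp
    also have "Suc ?i mod l = (Suc j + Suc n) mod l" by (simp add: mod_Suc_eq)
    finally show ?case using Suc by simp
  qed simp
  \<comment> \<open>After \<open>l - 1\<close> further steps from the successor of \<open>j\<close>
    the walk is back at \<open>j\<close>, without having used step \<open>j\<close>.\<close>
  from this[of "l - 1"] show ?thesis using assms(1) by simp
qed

text \<open>If step \<open>j\<close> were a bridge, the component \<open>C\<close> of one of its
  ends after deletion would be a cut of the labels crossed by step \<open>j\<close> alone. A vertex
  function separating this cut would then change exactly once around the closed walk, against
  \<open>cyclic_chain\<close>.\<close>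

lemma bridgeless_walk_multigraph:
  assumes sep: "separating r L"
    and lab: "\<And>F. F \<in> E \<Longrightarrow> \<exists>e\<in>L. F = e ` {..<r} \<and> (\<forall>i<r. lab F (e i) = Suc i)"
    and walk: "\<And>i. i < l \<Longrightarrow> F i \<in> E \<and> v i \<in> F i \<and> v (Suc i mod l) \<in> F i"
  shows "bridgeless (walk_multigraph lab l v F)"
  unfolding bridgeless_def
proof (intro allI notI)
  fix j
  define es where "es = walk_multigraph lab l v F"
  assume "is_bridge (walk_multigraph lab l v F) j"
  then have j: "j < l" and nr: "es ! j \<notin> (ugraph_rel (take j es @ drop (Suc j) es))\<^sup>*"
    by (auto simp: is_bridge_def es_def walk_multigraph_def)
  have nth: "es ! i = (lab (F i) (v i), lab (F i) (v (Suc i mod l)))" if "i < l" for i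
    using that by (simp add: es_def walk_multigraph_def)
  define C where "C = {b. (lab (F j) (v j), b) \<in> (ugraph_rel (take j es @ drop (Suc j) es))\<^sup>*}"
  have same: "lab (F i) (v i) \<in> C \<longleftrightarrow> lab (F i) (v (Suc i mod l)) \<in> C" if "i < l" "i \<noteq> j" for i
  proof -
    have len: "length es = l" by (simp add: es_def walk_multigraph_def)
    have "es ! i \<in> set (take j es @ drop (Suc j) es)"
    proof (cases "i < j")
      case True
      then have "take j es ! i = es ! i" "i < length (take j es)" using that len by auto
      then show ?thesis by (metis UnI1 nth_mem set_append)
    next
      case False
      then have "drop (Suc j) es ! (i - Suc j) = es ! i" "i - Suc j < length (drop (Suc j) es)"
        using that len by auto
      then show ?thesis by (metis UnI2 nth_mem set_append)
    qed
    then have "(lab (F i) (v i), lab (F i) (v (Suc i mod l))) \<in> ugraph_rel (take j es @ drop (Suc j) es)"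
      "(lab (F i) (v (Suc i mod l)), lab (F i) (v i)) \<in> ugraph_rel (take j es @ drop (Suc j) es)"
      using nth[OF that(1)] by (auto simp: ugraph_rel_def)
    then show ?thesis unfolding C_def by (auto intro: rtrancl_into_rtrancl)
  qed
  \<comment> \<open>Labels run from \<open>1\<close> to \<open>r\<close> but positions from
    \<open>0\<close>, hence \<open>Suc s\<close>; \<open>of_bool\<close> turns the cut into a
    partition with values in the naturals.\<close>
  obtain \<phi> where \<phi>: "separates r L (\<lambda>s. of_bool (Suc s \<in> C) :: nat) \<phi>"
    using sep unfolding separating_def by blast
  have \<phi>lab: "\<phi> x = \<phi> y \<longleftrightarrow> (lab G x \<in> C \<longleftrightarrow> lab G y \<in> C)" if G: "G \<in> E" "x \<in> G" "y \<in> G" for G x y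
  proof -
    obtain e where e: "e \<in> L" "G = e ` {..<r}" "\<forall>i<r. lab G (e i) = Suc i" using lab[OF G(1)] by blast
    obtain s t where "s < r" "t < r" "x = e s" "y = e t" using G(2,3) e(2) by blast
    then have "\<phi> x = \<phi> y \<longleftrightarrow> (of_bool (Suc s \<in> C) :: nat) = of_bool (Suc t \<in> C)"
      using separatesD[OF \<phi> e(1)] by blast
    then show ?thesis using e(3) \<open>s < r\<close> \<open>t < r\<close> \<open>x = e s\<close> \<open>y = e t\<close> by auto
  qed
  have "\<phi> (v (Suc j mod l)) = \<phi> (v j)"
    by (rule cyclic_chain[of j l "\<lambda>i. \<phi> (v i)"]) (use j \<phi>lab walk same in blast)+
  moreover have "lab (F j) (v j) \<in> C" "lab (F j) (v (Suc j mod l)) \<notin> C"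
    using nr nth[OF j] by (auto simp: C_def)
  ultimately show False using \<phi>lab walk[OF j] by metis
qed

section \<open>Girth and chromatic number\<close>

text \<open>The hyperedges of a Berge cycle have no leaf: each shares two distinct vertices with its
  neighbours on the cycle.\<close>

lemma berge_cycle_not_locally_acyclic:
  assumes cyc: "berge_cycle ((\<lambda>e. e ` {..<r}) ` L) l" and acyc: "locally_acyclic r s L"
  shows "s < l"
proof (rule ccontr)
  assume "\<not> s < l"
  obtain F x where F: "\<And>i. i < l \<Longrightarrow> F i \<in> (\<lambda>e. e ` {..<r}) ` L" "inj_on F {..<l}"
    and x: "inj_on x {..<l}" "\<And>i. i < l \<Longrightarrow> x i \<in> F i \<and> x i \<in> F (Suc i mod l)" and l: "2 \<le> l"
    using cyc unfolding berge_cycle_def by blast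
  have "\<forall>i. \<exists>e. i < l \<longrightarrow> e \<in> L \<and> F i = e ` {..<r}" using F(1) by blast
  then obtain e where e: "\<And>i. i < l \<Longrightarrow> e i \<in> L \<and> F i = e i ` {..<r}" by metis
  define T where "T = e ` {..<l}"
  have "card T \<le> s" using card_image_le[of "{..<l}" e] \<open>\<not> s < l\<close> by (simp add: T_def)
  moreover have "e 0 \<in> T" using l by (simp add: T_def)
  moreover have "T \<subseteq> L" "finite T" using e by (auto simp: T_def)
  ultimately obtain f where f: "f \<in> T" "leaf r {} T f" using acyc unfolding locally_acyclic_def by (metis empty_iff)
  then obtain i where i: "i < l" "f = e i" by (auto simp: T_def)
  \<comment> \<open>\<open>p\<close> is the predecessor of \<open>i\<close>. For
    \<open>l = 2\<close> it is also the successor, but \<open>x p\<close> and \<open>x i\<close>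
    still differ.\<close>
  obtain p where p: "p < l" "Suc p mod l = i" "p \<noteq> i"
  proof (cases i)
    case 0
    then show ?thesis using that[of "l - 1"] l by simp
  next
    case (Suc p)
    then show ?thesis using that[of p] i by simp
  qed
  define n where "n = Suc i mod l"
  have n: "n < l" "n \<noteq> i" using l i by (auto simp: n_def mod_Suc)
  obtain a where "\<forall>t<r. (f t \<in> {} \<longrightarrow> f t = a) \<and>
      (\<forall>f'\<in>T. f' \<noteq> f \<longrightarrow> (\<forall>t'<r. f t = f' t' \<longrightarrow> f t = a))"
    using leafD[OF f(2)] by (rule exE)
  then have a: "f t = a" if "t < r" "f' \<in> T" "f' \<noteq> f" "t' < r" "f t = f' t'" for t f' t'
    using that by blast
  have shared: "y = a" if y: "y \<in> F i" "y \<in> F q" "q < l" "q \<noteq> i" for y q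
  proof -
    have "F q \<noteq> F i" using F(2) that i by (metis inj_on_def lessThan_iff)
    then have q: "e q \<in> T" "e q \<noteq> f" using e that i by (auto simp: T_def)
    obtain t t' where "t < r" "y = f t" "t' < r" "y = e q t'"
      using y(1,2) e[OF i(1)] e[OF y(3)] i(2) by auto
    then show ?thesis using a[OF _ q] by metis
  qed
  have "x i = a" using shared[of "x i" n] x(2)[OF i(1)] n by (simp add: n_def)
  moreover have "x p = a" using shared[of "x p" p] x(2)[OF p(1)] p by simp
  ultimately show False using x(1) p i by (auto simp: inj_on_def)
qed

lemma chromatic_number_ge:
  assumes "unavoidable r k L" "finite L" "2 \<le> r" "0 < k" "\<And>e. e \<in> L \<Longrightarrow> inj_on e {..<r}"
  shows "k \<le> chromatic_number (\<Union>e\<in>L. e ` {..<r}) ((\<lambda>e. e ` {..<r}) ` L)"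
proof -
  let ?V = "\<Union>e\<in>L. e ` {..<r}" and ?E = "(\<lambda>e. e ` {..<r}) ` L"
  obtain m where m: "\<forall>x\<in>?V. x < m"
    using finite_nat_set_iff_bounded[of ?V] assms(2) by auto
  have "\<exists>x\<in>F. \<exists>y\<in>F. x \<noteq> y" if F: "F \<in> ?E" for F
  proof -
    obtain e where e: "e \<in> L" "F = e ` {..<r}" using F by blast
    then have "e 0 \<noteq> e 1" using inj_onD[OF assms(5)[OF e(1)], of 0 1] assms(3) by auto
    moreover have "e 0 \<in> F" "e 1 \<in> F" using e(2) assms(3) by auto
    ultimately show ?thesis by blast
  qed
  \<comment> \<open>The identity is a proper colouring, so the \<open>LEAST\<close> in the chromatic
    number is attained.\<close>
  then have "colourable ?V ?E m"
    using m unfolding colourable_def by (intro exI[of _ "\<lambda>x. x"]) blast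
  then have "colourable ?V ?E (chromatic_number ?V ?E)" unfolding chromatic_number_def by (rule LeastI)
  moreover have "\<not> colourable ?V ?E n" if "n < k" for n
  proof
    assume "colourable ?V ?E n"
    then obtain c :: "nat \<Rightarrow> nat" where c: "\<forall>x\<in>?V. c x < n" "\<forall>F\<in>?E. \<exists>x\<in>F. \<exists>y\<in>F. c x \<noteq> c y"
      unfolding colourable_def by blast
    \<comment> \<open>\<open>unavoidable\<close> speaks of colourings of all naturals, so
      \<open>c\<close> is extended by the colour \<open>0\<close>, which is below
      \<open>k\<close>.\<close>
    define c' where "c' v = (if v \<in> ?V then c v else 0)" for v
    have "c' v < k" for v
    proof (cases "v \<in> ?V")
      case True
      then have "c v < n" using c(1) by blast
      then show ?thesis using True that by (simp add: c'_def)
    next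
      case False
      then show ?thesis unfolding c'_def using assms(4) by (simp only: if_False)
    qed
    then obtain e q where e: "e \<in> L" "\<forall>i<r. c' (e i) = q"
      using assms(1) unfolding unavoidable_def by blast
    have "c x = q" if "x \<in> e ` {..<r}" for x
    proof -
      have "x \<in> ?V" using that e(1) by blast
      moreover have "c' x = q" using that e(2) by blast
      ultimately show ?thesis unfolding c'_def by (simp only: if_True)
    qed
    then show False using c(2) e(1) by (metis image_eqI)
  qed
  ultimately show ?thesis by (meson not_le)
qed

theorem theorem3p4:
  fixes r k g :: nat
  assumes "r \<ge> 3" and "k > 0" and "g > 0"
  shows "\<exists>(V :: nat set) (E :: nat set set).
           finite V \<and> uniform r V E \<and> tranquil r V E \<and>
           k \<le> chromatic_number V E \<and> enat g \<le> girth E"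
proof -
  obtain L where L: "finite L" "separating r L" "unavoidable r k L" "locally_acyclic r g L"
    using unavoidable_separating_locally_acyclic by blast
  define V where "V = (\<Union>e\<in>L. e ` {..<r})"
  define E where "E = (\<lambda>e. e ` {..<r}) ` L"
  have inj: "inj_on e {..<r}" if "e \<in> L" for e using separating_inj_on[OF L(2) that] .
  have "finite V" using L(1) by (simp add: V_def)
  moreover have "uniform r V E"
    unfolding uniform_def hypergraph_def using inj by (auto simp: V_def E_def card_image)
  moreover have "tranquil r V E"
  proof -
    have "\<forall>F. \<exists>e. F \<in> E \<longrightarrow> e \<in> L \<and> F = e ` {..<r}" by (auto simp: E_def)
    \<comment> \<open>One labelled hyperedge is fixed for each vertex set in \<open>E\<close>, and
      \<open>lab\<close> shifts its positions from \<open>0, ..., r - 1\<close> to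
      \<open>1, ..., r\<close>.\<close>
    then obtain edge where edge: "\<And>F. F \<in> E \<Longrightarrow> edge F \<in> L \<and> F = edge F ` {..<r}" by metis
    define lab where "lab F x = Suc (inv_into {..<r} (edge F) x)" for F x
    have lab: "\<forall>i<r. lab F (edge F i) = Suc i" if "F \<in> E" for F
      using inj edge[OF that] by (simp add: lab_def)
    have "bij_betw (lab F) F {1..r}" if "F \<in> E" for F
    proof -
      have "bij_betw (inv_into {..<r} (edge F)) F {..<r}"
        using edge[OF that] inj by (metis bij_betw_imageI bij_betw_inv_into)
      moreover have "bij_betw Suc {..<r} {1..r}"
        by (simp add: bij_betw_def image_Suc_lessThan)
      ultimately have "bij_betw (Suc \<circ> inv_into {..<r} (edge F)) F {1..r}" by (rule bij_betw_trans)
      then show ?thesis by (simp add: lab_def[abs_def] o_def)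
    qed
    moreover have "bridgeless (walk_multigraph lab l v F)" if "closed_walk E l v F" for l v F
    proof (rule bridgeless_walk_multigraph[OF L(2)])
      show "\<exists>e\<in>L. G = e ` {..<r} \<and> (\<forall>i<r. lab G (e i) = Suc i)" if "G \<in> E" for G
        using edge[OF that] lab[OF that] by blast
      show "F i \<in> E \<and> v i \<in> F i \<and> v (Suc i mod l) \<in> F i" if "i < l" for i
        using \<open>closed_walk E l v F\<close> that by (simp add: closed_walk_def)
    qed
    ultimately show ?thesis unfolding tranquil_def by blast
  qed
  moreover have "k \<le> chromatic_number V E"
    unfolding V_def E_def using chromatic_number_ge[OF L(3,1) _ assms(2) inj] assms(1) by simp
  moreover have "enat g \<le> girth E"
    unfolding girth_def
  proof (rule INF_greatest)
    fix l assume "l \<in> {l. berge_cycle E l}"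
    then show "enat g \<le> enat l"
      using berge_cycle_not_locally_acyclic[of r L l g] L(4) by (simp add: E_def)
  qed
  ultimately show ?thesis by blast
qed

end
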